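(* Let $X\in\mathbb{R}^{m\times N}$ be full rank with $m\ge N$, and let $w\in\mathbb{R}^N$. Run OPTQ on $w$ with Hessian $H=X^\top X$ (i.e. with $\lambda=0$), producing intermediate vectors $w^{(0)},\dots,w^{(N)}$ and the quantized vector $q=w^{(N)}$. Let $e_t=Xw-Xw^{(t)}=Xw-\sum_{j=1}^{t}q_jX_j-\sum_{j=t+1}^{N}w^{(t)}_jX_j$ for $t=0,\dots,N$. Then for every $t=1,\dots,N$, $$e_t=P_{X_{\ge t+1}^{\perp}}\big(w^{(t-1)}_t-q_t\big)X_t+e_{t-1},\qquad\text{and}\qquad e_N=\sum_{j=1}^{N}P_{X_{\ge j+1}^{\perp}}\big(w^{(j-1)}_j-q_j\big)X_j .$$ Moreover, $$\|Xw-Xq\|_2^2=\sum_{j=1}^{N}\big|w^{(j-1)}_j-q_j\big|^2\,\big\|P_{X_{\ge j+1}^{\perp}}X_j\big\|_2^2 .$$ In particular, when the infinite alphabet $\mathcal{A}^\delta$ is used, $$\|Xw-Xq\|_2\le\frac{\delta}{2}\sqrt{N}\cdot\min\Big\{\max_{j}\|P_{X_{\ge j+1}^{\perp}}X_j\|_2,\ \sqrt{\tfrac{\|X\|_F^2}{N}}\Big\}.$$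
   Context: Notation: for a matrix $A$ with columns $A_1,\dots,A_n$, $A_{\ge j}$ is the submatrix $(A_j,\dots,A_n)$; $P_{A^\perp}=I-AA^\dagger$ is the orthogonal projection onto the orthogonal complement of the column space of $A$ (equal to $I$ if $A$ has no columns, as for $X_{\ge N+1}$). For a vector $v$, $v_{\ge j}=(v_j,\dots,v_n)^\top$. Quantizer: for an alphabet $\mathcal{A}\subset\mathbb{R}$, $\mathcal{Q}(z)=\arg\min_{p\in\mathcal{A}}|z-p|$ (round to nearest, ties broken by a fixed rule). For $\delta>0$, the infinite alphabet is $\mathcal{A}^\delta=\{k\delta:k\in\mathbb{Z}\}$. OPTQ with an invertible symmetric positive definite Hessian $H\in\mathbb{R}^{N\times N}$, applied to $w\in\mathbb{R}^N$: let $H^{-1}=LL^\top$ be the Cholesky decomposition ($L$ lower triangular). Set $w^{(0)}=w$. For $t=1,\dots,N$: set $q_t=\mathcal{Q}(w^{(t-1)}_t)$ and $w^{(t)}_{\ge t+1}=w^{(t-1)}_{\ge t+1}+(q_t-w^{(t-1)}_t)\,L_{\ge t+1,t}/L_{tt}$, where $L_{\ge t+1,t}$ is the part of the $t$-th column of $L$ below the diagonal. The state after step $t$ is $w^{(t)}=(q_1,\dots,q_t,w^{(t)}_{\ge t+1})$; the output is $q=w^{(N)}$. *)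

theory Defs
  imports Complex_Main "Jordan_Normal_Form.DL_Rank" "Jordan_Normal_Form.Gauss_Jordan_Elimination"
begin

text \<open>
  Rows, columns and vector entries are indexed from 0, so column \<open>X\<^sub>j\<close> of the usual
  1-based notation is \<open>col X (j - 1)\<close>.
\<close>

definition vec_norm2 :: "real vec \<Rightarrow> real" where
  "vec_norm2 v = sqrt (v \<bullet> v)"

definition frobenius_norm :: "real mat \<Rightarrow> real" where
  "frobenius_norm A = sqrt (\<Sum>i<dim_row A. \<Sum>j<dim_col A. (A $$ (i, j))\<^sup>2)"

text \<open>The Moore--Penrose pseudoinverse, characterised by the four Penrose equations.\<close>

definition is_pinv :: "real mat \<Rightarrow> real mat \<Rightarrow> bool" where
  "is_pinv A B \<longleftrightarrow>
     B \<in> carrier_mat (dim_col A) (dim_row A) \<and>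
     A * B * A = A \<and>
     B * A * B = B \<and>
     transpose_mat (A * B) = A * B \<and>
     transpose_mat (B * A) = B * A"

definition pinv :: "real mat \<Rightarrow> real mat" where
  "pinv A = (THE B. is_pinv A B)"

text \<open>
  \<open>P\<^bsub>A\<^sup>\<bottom>\<^esub> = I - A A\<^sup>\<dagger>\<close>. If \<open>A\<close> is an \<open>m \<times> 0\<close> matrix, then \<open>A * pinv A\<close> is the \<open>m \<times> m\<close> zero
  matrix, so that this is the identity.
\<close>

definition perp_proj :: "real mat \<Rightarrow> real mat" where
  "perp_proj A = 1\<^sub>m (dim_row A) - A * pinv A"

text \<open>The submatrix of the columns with (0-based) index at least \<open>j\<close>.\<close>

definition cols_from :: "real mat \<Rightarrow> nat \<Rightarrow> real mat" where
  "cols_from A j = mat_of_cols (dim_row A) (drop j (cols A))"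

text \<open>\<open>Q\<close> being a function is what expresses that ties are broken by a fixed rule.\<close>

definition is_quantizer :: "real set \<Rightarrow> (real \<Rightarrow> real) \<Rightarrow> bool" where
  "is_quantizer \<A> Q \<longleftrightarrow> (\<forall>z. is_arg_min (\<lambda>p. \<bar>z - p\<bar>) (\<lambda>p. p \<in> \<A>) (Q z))"

definition infinite_alphabet :: "real \<Rightarrow> real set" where
  "infinite_alphabet \<delta> = {of_int k * \<delta> | k :: int. True}"

text \<open>
  \<open>L\<close> is the Cholesky factor of \<open>A\<close>; the diagonal is taken positive, which makes it unique.
\<close>

definition is_cholesky_factor :: "real mat \<Rightarrow> real mat \<Rightarrow> bool" where
  "is_cholesky_factor A L \<longleftrightarrow>
     L \<in> carrier_mat (dim_row A) (dim_row A) \<and>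
     (\<forall>i<dim_row A. \<forall>j<dim_row A. i < j \<longrightarrow> L $$ (i, j) = 0) \<and>
     (\<forall>i<dim_row A. 0 < L $$ (i, i)) \<and>
     A = L * transpose_mat L"

text \<open>
  \<open>optq_state Q L w t\<close> is \<open>w\<^sup>(\<^sup>t\<^sup>)\<close>, the state of OPTQ after \<open>t\<close> steps, where \<open>L\<close> is the Cholesky
  factor of the inverse Hessian. Step number \<open>t + 1\<close> quantizes the entry of 0-based index \<open>t\<close>.
\<close>

fun optq_state :: "(real \<Rightarrow> real) \<Rightarrow> real mat \<Rightarrow> real vec \<Rightarrow> nat \<Rightarrow> real vec" where
  "optq_state Q L w 0 = w"
| "optq_state Q L w (Suc t) =
     (let v = optq_state Q L w t; p = Q (v $ t)
      in vec (dim_vec w) (\<lambda>i.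
           if i < t then v $ i
           else if i = t then p
           else v $ i + (p - v $ t) * (L $$ (i, t) / L $$ (t, t))))"

end

theory Submission
  imports Defs
begin

text \<open>
  Put \<open>Y = X L\<close>. Since \<open>L L\<^sup>T = (X\<^sup>T X)\<^sup>-\<^sup>1\<close>, the columns of \<open>Y\<close> are orthonormal, and \<open>Y\<^sup>T X = L\<^sup>-\<^sup>1\<close> is lower
  triangular, i.e. \<open>Y\<^sub>t\<close> is orthogonal to \<open>X\<^sub>j\<close> for \<open>j > t\<close>. As \<open>L\<close> is lower triangular too,
  \<open>Y\<^sub>t / L\<^sub>t\<^sub>t\<close> differs from \<open>X\<^sub>t\<close> by a combination of the columns \<open>X\<^sub>j\<close> with \<open>j > t\<close>; hence it is the
  projection of \<open>X\<^sub>t\<close> onto the orthogonal complement of these columns. A step of OPTQ subtracts a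
  multiple of the column \<open>L\<^sub>t\<close> from the state, so it changes the error by the corresponding multiple
  of this projection. The error is thus a sum of pairwise orthogonal vectors, and its norm is given by
  Pythagoras.
\<close>

section \<open>Full column rank and injectivity\<close>

text \<open>A maximal independent subset of the set of columns has \<open>rank A = nc\<close>
  elements, so this set cannot be smaller than the list of columns. Distinctness is needed because
  linear independence is stated for a set, which does not see repetitions.\<close>

lemma (in vec_space) full_col_rank_distinct_cols:
  assumes A: "A \<in> carrier_mat n nc" and rank: "rank A = nc"
  shows "distinct (cols A)"
proof (rule card_distinct)
  obtain S where S: "maximal S (\<lambda>T. T \<subseteq> set (cols A) \<and> lin_indpt T)"
    using maximal_exists[of "(\<lambda>T. T \<subseteq> set (cols A) \<and> lin_indpt T)" "card (set (cols A))" "{}"]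
    by (meson List.finite_set card_mono empty_iff empty_subsetI finite_lin_indpt2 rev_finite_subset)
  then have "card S \<le> card (set (cols A))" by (simp add: card_mono maximal_def)
  then have "length (cols A) \<le> card (set (cols A))"
    using rank_card_indpt[OF A S] A rank by simp
  then show "card (set (cols A)) = length (cols A)"
    using card_length le_antisym by blast
qed

lemma (in vec_space) full_col_rank_mult_eq_0:
  assumes A: "A \<in> carrier_mat n nc" and rank: "rank A = nc"
    and v: "v \<in> carrier_vec nc" "A *\<^sub>v v = 0\<^sub>v n"
  shows "v = 0\<^sub>v nc"
  using full_col_rank_distinct_cols[OF A rank] full_rank_lin_indpt[OF A rank] lin_depI[OF A v(1) _ v(2)]
  by blast

lemma scalar_prod_self_ge_0: "0 \<le> (v :: real vec) \<bullet> v"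
  by (simp add: scalar_prod_def sum_nonneg)

lemma scalar_prod_self_eq_0:
  fixes v :: "real vec"
  assumes "v \<in> carrier_vec n" "v \<bullet> v = 0"
  shows "v = 0\<^sub>v n"
  using conjugate_square_eq_0_vec[OF assms(1)] assms(2) by simp

lemma vec_norm2_square: "(vec_norm2 v)\<^sup>2 = v \<bullet> v"
  by (simp add: vec_norm2_def scalar_prod_self_ge_0)

lemma vec_norm2_ge_0: "0 \<le> vec_norm2 v"
  by (simp add: vec_norm2_def scalar_prod_self_ge_0)

section \<open>The Gram matrix and the pseudoinverse\<close>

text \<open>If the Gram matrix kills \<open>v\<close>, then the squared norm of
  \<open>A *\<^sub>v v\<close> is 0, so \<open>v = 0\<close> by injectivity. Hence the determinant
  is nonzero.\<close>

lemma gram_inverse_exists: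
  fixes A :: "real mat"
  assumes A: "A \<in> carrier_mat m k"
    and inj: "\<forall>v\<in>carrier_vec k. A *\<^sub>v v = 0\<^sub>v m \<longrightarrow> v = 0\<^sub>v k"
  shows "\<exists>M. mat_inverse (transpose_mat A * A) = Some M"
proof -
  let ?G = "transpose_mat A * A"
  have G: "?G \<in> carrier_mat k k" using A by simp
  have "det ?G \<noteq> 0"
  proof
    assume "det ?G = 0"
    then obtain v where v: "v \<in> carrier_vec k" "v \<noteq> 0\<^sub>v k" "?G *\<^sub>v v = 0\<^sub>v k"
      using det_0_iff_vec_prod_zero[OF G] by blast
    have "(A *\<^sub>v v) \<bullet> (A *\<^sub>v v) = (transpose_mat A *\<^sub>v (A *\<^sub>v v)) \<bullet> v"
      by (rule transpose_vec_mult_scalar[OF A v(1), symmetric]) (use A v in simp)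
    also have "transpose_mat A *\<^sub>v (A *\<^sub>v v) = ?G *\<^sub>v v"
      by (rule assoc_mult_mat_vec[symmetric]) (use A v in auto)
    finally have "(A *\<^sub>v v) \<bullet> (A *\<^sub>v v) = 0" using v by simp
    then have "A *\<^sub>v v = 0\<^sub>v m" using A v by (intro scalar_prod_self_eq_0) auto
    then show False using inj v by blast
  qed
  then have "?G \<in> Units (ring_mat TYPE(real) k ())" by (rule det_non_zero_imp_unit[OF G])
  then show ?thesis using mat_inverse(1)[OF G, of "()"] by (cases "mat_inverse ?G") auto
qed

text \<open>Penrose's argument: symmetry of the products gives \<open>A * B = A * C\<close> and
  \<open>B * A = C * A\<close>, whence \<open>B = B * A * B = C * A * C = C\<close>. This makes the
  definite description in \<open>pinv\<close> usable.\<close>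

lemma is_pinv_unique:
  assumes B: "is_pinv A B" and C: "is_pinv A C"
  shows "B = C"
proof -
  define m n where mn: "m = dim_row A" "n = dim_col A"
  have cA: "A \<in> carrier_mat m n" using mn by auto
  have cB: "B \<in> carrier_mat n m" and cC: "C \<in> carrier_mat n m"
    using B C mn by (auto simp: is_pinv_def)
  note assoc = assoc_mult_mat
  have "A * B = (A * C) * (A * B)"
    using C cA cB cC assoc[of "A * C" m m A n B m] by (auto simp: is_pinv_def)
  also have "\<dots> = transpose_mat (A * C) * transpose_mat (A * B)"
    using B C by (simp add: is_pinv_def)
  also have "\<dots> = transpose_mat ((A * B) * (A * C))"
    by (rule transpose_mult[symmetric]) (use cA cB cC in auto)
  also have "(A * B) * (A * C) = A * C"
    using B cA cB cC assoc[of "A * B" m m A n C m] by (auto simp: is_pinv_def)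
  finally have AB: "A * B = A * C" using C by (simp add: is_pinv_def)
  have "B * A = B * (A * C * A)" using C by (simp add: is_pinv_def)
  also have "\<dots> = B * (A * (C * A))" using cA cC by simp
  also have "\<dots> = (B * A) * (C * A)"
    by (rule assoc_mult_mat[symmetric]) (use cA cB cC in auto)
  also have "\<dots> = transpose_mat (B * A) * transpose_mat (C * A)"
    using B C by (simp add: is_pinv_def)
  also have "\<dots> = transpose_mat ((C * A) * (B * A))"
    by (rule transpose_mult[symmetric]) (use cA cB cC in auto)
  also have "(C * A) * (B * A) = C * (A * (B * A))"
    by (rule assoc_mult_mat) (use cA cB cC in auto)
  also have "A * (B * A) = A * B * A" using cA cB by simp
  also have "C * (A * B * A) = C * A" using B by (simp add: is_pinv_def)
  finally have BA: "B * A = C * A" using C by (simp add: is_pinv_def)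
  have "B = B * A * B" using B by (simp add: is_pinv_def)
  also have "\<dots> = C * (A * B)" using cA cB cC by (simp add: BA)
  also have "\<dots> = C * A * C" using cA cB cC by (simp add: AB)
  also have "\<dots> = C" using C by (simp add: is_pinv_def)
  finally show ?thesis .
qed

text \<open>For injective \<open>A\<close> the pseudoinverse is the explicit left inverse
  \<open>M * ?T\<close>, with \<open>M\<close> the inverse Gram matrix. The case
  \<open>k = 0\<close> is included, as the projection for the last column requires.\<close>

lemma is_pinv_pinv:
  assumes A: "A \<in> carrier_mat m k"
    and inj: "\<forall>v\<in>carrier_vec k. A *\<^sub>v v = 0\<^sub>v m \<longrightarrow> v = 0\<^sub>v k"
  shows "is_pinv A (pinv A)"
proof -
  let ?T = "transpose_mat A" and ?G = "transpose_mat A * A"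
  have G: "?G \<in> carrier_mat k k" and T: "?T \<in> carrier_mat k m" using A by auto
  obtain M where "mat_inverse ?G = Some M" using gram_inverse_exists[OF A inj] by blast
  then have M: "?G * M = 1\<^sub>m k" "M * ?G = 1\<^sub>m k" "M \<in> carrier_mat k k"
    using mat_inverse(2)[OF G] by auto
  have GT: "transpose_mat ?G = ?G" using transpose_mult[OF T A] by simp
  \<comment> \<open>Transposing \<open>?G * M = 1\<close> shows that the transpose of
    \<open>M\<close> is a left inverse of the symmetric \<open>?G\<close>, and \<open>M\<close> is a
    right inverse.\<close>
  have MT: "transpose_mat M = M"
  proof -
    have "transpose_mat M * ?G = 1\<^sub>m k"
      using transpose_mult[OF G M(3)] M(1) GT by simp
    then have "transpose_mat M * ?G * M = M" using M by simp
    moreover have "transpose_mat M * ?G * M = transpose_mat M * (?G * M)"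
      by (rule assoc_mult_mat) (use G M in auto)
    ultimately show ?thesis using M by simp
  qed
  have BA: "(M * ?T) * A = 1\<^sub>m k" using M A T by simp
  have "is_pinv A (M * ?T)"
    unfolding is_pinv_def
  proof (intro conjI)
    show "M * ?T \<in> carrier_mat (dim_col A) (dim_row A)" using A M by auto
    have "A * (M * ?T) * A = A * (M * ?T * A)"
      by (rule assoc_mult_mat) (use A M T in auto)
    then show "A * (M * ?T) * A = A" using BA A by simp
    show "M * ?T * A * (M * ?T) = M * ?T" unfolding BA using M T by simp
    show "transpose_mat (M * ?T * A) = M * ?T * A" unfolding BA by simp
    have "transpose_mat (A * (M * ?T)) = transpose_mat (M * ?T) * ?T"
      by (rule transpose_mult) (use A M T in auto)
    also have "transpose_mat (M * ?T) = A * M"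
      using transpose_mult[OF M(3) T] MT by simp
    finally show "transpose_mat (A * (M * ?T)) = A * (M * ?T)" using A M T by simp
  qed
  then show ?thesis unfolding pinv_def using is_pinv_unique by (metis theI)
qed

lemma add_diff_cancel_right_vec:
  assumes "v \<in> carrier_vec n" "w \<in> carrier_vec n"
  shows "v + w - w = (v :: 'a :: group_add vec)"
  using assms by (intro eq_vecI) auto

section \<open>Orthogonal projection and trailing columns\<close>

text \<open>By symmetry \<open>A * pinv A\<close> factors through the transpose of \<open>A\<close>
  and so kills \<open>u\<close>; by the first Penrose equation it fixes
  \<open>A *\<^sub>v x\<close>. Projections can thus be read off from an orthogonal splitting,
  without computing \<open>pinv A\<close>.\<close>

lemma perp_proj_mult_eq:
  assumes A: "A \<in> carrier_mat m k"
    and inj: "\<forall>v\<in>carrier_vec k. A *\<^sub>v v = 0\<^sub>v m \<longrightarrow> v = 0\<^sub>v k"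
    and u: "u \<in> carrier_vec m" "transpose_mat A *\<^sub>v u = 0\<^sub>v k"
    and x: "x \<in> carrier_vec k"
  shows "perp_proj A *\<^sub>v (u + A *\<^sub>v x) = u"
proof -
  let ?B = "pinv A"
  have p: "is_pinv A ?B" by (rule is_pinv_pinv[OF A inj])
  then have B: "?B \<in> carrier_mat k m" using A by (auto simp: is_pinv_def)
  have "A * ?B = transpose_mat (A * ?B)" using p by (simp add: is_pinv_def)
  also have "\<dots> = transpose_mat ?B * transpose_mat A" by (rule transpose_mult[OF A B])
  finally have "(A * ?B) *\<^sub>v u = transpose_mat ?B *\<^sub>v (transpose_mat A *\<^sub>v u)"
    using A B u by simp
  also have "\<dots> = 0\<^sub>v m" using B u by (auto intro!: eq_vecI)
  finally have 1: "(A * ?B) *\<^sub>v u = 0\<^sub>v m" .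
  have "(A * ?B) *\<^sub>v (A *\<^sub>v x) = (A * ?B * A) *\<^sub>v x"
    by (rule assoc_mult_mat_vec[symmetric]) (use A B x in auto)
  then have 2: "(A * ?B) *\<^sub>v (A *\<^sub>v x) = A *\<^sub>v x" using p by (simp add: is_pinv_def)
  have AB: "A * ?B \<in> carrier_mat m m" and Ax: "A *\<^sub>v x \<in> carrier_vec m" using A B x by auto
  have "perp_proj A *\<^sub>v (u + A *\<^sub>v x) = (u + A *\<^sub>v x) - (A * ?B) *\<^sub>v (u + A *\<^sub>v x)"
    unfolding perp_proj_def using A AB u Ax
      minus_mult_distrib_mat_vec[of "1\<^sub>m m" m m "A * ?B" "u + A *\<^sub>v x"] by simp
  also have "(A * ?B) *\<^sub>v (u + A *\<^sub>v x) = A *\<^sub>v x"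
    using mult_add_distrib_mat_vec[OF AB u(1) Ax] 1 2 Ax by simp
  also have "(u + A *\<^sub>v x) - A *\<^sub>v x = u" by (rule add_diff_cancel_right_vec[OF u(1) Ax])
  finally show ?thesis .
qed

lemma perp_proj_carrier:
  assumes A: "A \<in> carrier_mat m k"
    and inj: "\<forall>v\<in>carrier_vec k. A *\<^sub>v v = 0\<^sub>v m \<longrightarrow> v = 0\<^sub>v k"
  shows "perp_proj A \<in> carrier_mat m m"
  using is_pinv_pinv[OF A inj] A by (auto simp: perp_proj_def is_pinv_def)

lemma cols_from_carrier: "X \<in> carrier_mat m N \<Longrightarrow> cols_from X j \<in> carrier_mat m (N - j)"
  by (auto simp: cols_from_def)

lemma cols_from_index:
  assumes "X \<in> carrier_mat m N" "i < m" "k < N - j"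
  shows "cols_from X j $$ (i, k) = X $$ (i, j + k)"
  using assms by (simp add: cols_from_def mat_of_cols_index)

lemma cols_from_col:
  assumes "X \<in> carrier_mat m N" "k < N - j"
  shows "col (cols_from X j) k = col X (j + k)"
  using assms cols_from_carrier[OF assms(1), of j]
  by (intro eq_vecI) (auto simp: cols_from_index)

lemma cols_from_mult_vec:
  fixes X :: "real mat"
  assumes X: "X \<in> carrier_mat m N" and v: "v \<in> carrier_vec N"
    and 0: "\<And>i. i < j \<Longrightarrow> i < N \<Longrightarrow> v $ i = 0"
  shows "cols_from X j *\<^sub>v vec (N - j) (\<lambda>i. v $ (j + i)) = X *\<^sub>v v"
proof (rule eq_vecI)
  fix i assume "i < dim_vec (X *\<^sub>v v)"
  then have i: "i < m" using X by simp
  have "(cols_from X j *\<^sub>v vec (N - j) (\<lambda>i. v $ (j + i))) $ i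
      = (\<Sum>k<N - j. X $$ (i, j + k) * v $ (j + k))"
    using cols_from_carrier[OF X, of j] i X
    by (auto simp: scalar_prod_def cols_from_index atLeast0LessThan intro!: sum.cong)
  also have "\<dots> = (\<Sum>k\<in>{j..<N}. X $$ (i, k) * v $ k)"
    by (rule sum.reindex_bij_witness[of _ "\<lambda>k. k - j" "\<lambda>k. j + k"]) auto
  also have "\<dots> = (\<Sum>k<N. X $$ (i, k) * v $ k)"
    by (rule sum.mono_neutral_left) (auto simp: 0)
  also have "\<dots> = (X *\<^sub>v v) $ i"
    using i X v by (auto simp: scalar_prod_def atLeast0LessThan intro!: sum.cong)
  finally show "(cols_from X j *\<^sub>v vec (N - j) (\<lambda>i. v $ (j + i))) $ i = (X *\<^sub>v v) $ i" .
qed (use X cols_from_carrier[OF X, of j] in auto)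

text \<open>A kernel vector of the trailing columns, padded with \<open>j\<close> leading zeros, is
  a kernel vector of \<open>X\<close>.\<close>

lemma cols_from_inj:
  fixes X :: "real mat"
  assumes X: "X \<in> carrier_mat m N"
    and inj: "\<forall>v\<in>carrier_vec N. X *\<^sub>v v = 0\<^sub>v m \<longrightarrow> v = 0\<^sub>v N"
  shows "\<forall>v\<in>carrier_vec (N - j). cols_from X j *\<^sub>v v = 0\<^sub>v m \<longrightarrow> v = 0\<^sub>v (N - j)"
proof (intro ballI impI)
  fix v :: "real vec"
  assume v: "v \<in> carrier_vec (N - j)" "cols_from X j *\<^sub>v v = 0\<^sub>v m"
  define x where "x = vec N (\<lambda>i. if i < j then 0 else v $ (i - j))"
  have vx: "v = vec (N - j) (\<lambda>i. x $ (j + i))" using v by (auto simp: x_def intro!: eq_vecI)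
  have "cols_from X j *\<^sub>v vec (N - j) (\<lambda>i. x $ (j + i)) = X *\<^sub>v x"
    by (rule cols_from_mult_vec[OF X]) (auto simp: x_def)
  then have "X *\<^sub>v x = 0\<^sub>v m" using v(2) vx by simp
  then have "x = 0\<^sub>v N" using inj by (simp add: x_def)
  then show "v = 0\<^sub>v (N - j)" unfolding vx by (auto intro!: eq_vecI)
qed

section \<open>The Cholesky factor of the inverse Gram matrix\<close>

text \<open>Forward substitution: in entry \<open>(i, j)\<close> of \<open>L * K\<close>, the terms
  with \<open>k < i\<close> vanish by induction and those with \<open>k > i\<close> by triangularity
  of \<open>L\<close>. What remains is \<open>L $$ (i, i) * K $$ (i, j) = 0\<close>.\<close>

lemma inverse_lower_triangular:
  fixes L K :: "real mat"
  assumes L: "L \<in> carrier_mat N N" and K: "K \<in> carrier_mat N N" and LK: "L * K = 1\<^sub>m N"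
    and tri: "\<And>i j. i < j \<Longrightarrow> j < N \<Longrightarrow> L $$ (i, j) = 0"
    and diag: "\<And>i. i < N \<Longrightarrow> L $$ (i, i) \<noteq> 0"
    and ij: "i < j" "j < N"
  shows "K $$ (i, j) = 0"
  using ij(1)
proof (induction i rule: less_induct)
  case (less i)
  then have i: "i < N" using ij by simp
  have "0 = (L * K) $$ (i, j)" using LK less ij i by simp
  also have "\<dots> = (\<Sum>k<N. L $$ (i, k) * K $$ (k, j))"
    using L K i ij by (simp add: scalar_prod_def atLeast0LessThan)
  also have "\<dots> = (\<Sum>k\<in>{i}. L $$ (i, k) * K $$ (k, j))"
  proof (rule sum.mono_neutral_right)
    show "\<forall>k\<in>{..<N} - {i}. L $$ (i, k) * K $$ (k, j) = 0"
    proof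
      fix k assume "k \<in> {..<N} - {i}"
      then consider "k < i" | "i < k" "k < N" by fastforce
      then show "L $$ (i, k) * K $$ (k, j) = 0"
        by cases (use less tri in auto)
    qed
  qed (use i in auto)
  finally show ?case using diag i by simp
qed

text \<open>With \<open>K = (X L)\<^sup>T X = L\<^sup>T ?G\<close>, the identity
  \<open>L L\<^sup>T ?G = 1\<close> reads \<open>L K = 1\<close>. So \<open>K\<close> is the inverse
  of \<open>L\<close>, hence lower triangular, and \<open>K L = 1\<close> says that
  \<open>X L\<close> has orthonormal columns.\<close>

lemma cholesky_orthonormal:
  fixes X L :: "real mat"
  assumes X: "X \<in> carrier_mat m N"
    and inj: "\<forall>v\<in>carrier_vec N. X *\<^sub>v v = 0\<^sub>v m \<longrightarrow> v = 0\<^sub>v N"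
    and L: "is_cholesky_factor (the (mat_inverse (transpose_mat X * X))) L"
  shows "L \<in> carrier_mat N N"
    and "\<And>i j. i < j \<Longrightarrow> j < N \<Longrightarrow> L $$ (i, j) = 0"
    and "\<And>i. i < N \<Longrightarrow> 0 < L $$ (i, i)"
    and "transpose_mat (X * L) * (X * L) = 1\<^sub>m N"
    and "\<And>i j. i < j \<Longrightarrow> j < N \<Longrightarrow> (transpose_mat (X * L) * X) $$ (i, j) = 0"
proof -
  let ?G = "transpose_mat X * X"
  have G: "?G \<in> carrier_mat N N" using X by simp
  \<comment> \<open>Injectivity ensures that \<open>the\<close> is applied to a \<open>Some\<close>,
    so that \<open>L\<close> really factors the inverse of \<open>?G\<close>.\<close>
  obtain M where Mi: "mat_inverse ?G = Some M" using gram_inverse_exists[OF X inj] by blast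
  then have M: "?G * M = 1\<^sub>m N" "M \<in> carrier_mat N N"
    using mat_inverse(2)[OF G] by auto
  show cL: "L \<in> carrier_mat N N"
    and tri: "\<And>i j. i < j \<Longrightarrow> j < N \<Longrightarrow> L $$ (i, j) = 0"
    and diag: "\<And>i. i < N \<Longrightarrow> 0 < L $$ (i, i)"
    using L M by (auto simp: Mi is_cholesky_factor_def)
  let ?LT = "transpose_mat L"
  have LT: "?LT \<in> carrier_mat N N" and XT: "transpose_mat X \<in> carrier_mat N m" using cL X by auto
  have MLL: "M = L * ?LT" using L by (simp add: Mi is_cholesky_factor_def)
  have K_eq: "transpose_mat (X * L) * X = ?LT * ?G"
    unfolding transpose_mult[OF X cL] by (rule assoc_mult_mat[OF LT XT X])
  have K: "transpose_mat (X * L) * X \<in> carrier_mat N N"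
    using X cL by (intro carrier_matI) auto
  have "M * ?G = 1\<^sub>m N" by (rule mat_mult_left_right_inverse[OF G M(2) M(1)])
  then have LK: "L * (transpose_mat (X * L) * X) = 1\<^sub>m N"
    unfolding K_eq MLL using assoc_mult_mat[OF cL LT G] by simp
  from mat_mult_left_right_inverse[OF cL K LK]
  have "transpose_mat (X * L) * X * L = 1\<^sub>m N" .
  then show "transpose_mat (X * L) * (X * L) = 1\<^sub>m N"
    using assoc_mult_mat[of "transpose_mat (X * L)" N m X N L N] X cL by simp
  show "(transpose_mat (X * L) * X) $$ (i, j) = 0" if "i < j" "j < N" for i j
    using inverse_lower_triangular[OF cL K LK tri _ that] diag by fastforce
qed

text \<open>Column \<open>t\<close> of \<open>X\<close> splits into \<open>u\<close> and a
  combination of later columns, and \<open>u\<close> is orthogonal to all of these. The inequality,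
  Pythagoras for this splitting, serves the Frobenius bound.\<close>

lemma perp_proj_col:
  fixes X L :: "real mat"
  assumes X: "X \<in> carrier_mat m N"
    and inj: "\<forall>v\<in>carrier_vec N. X *\<^sub>v v = 0\<^sub>v m \<longrightarrow> v = 0\<^sub>v N"
    and L: "is_cholesky_factor (the (mat_inverse (transpose_mat X * X))) L"
    and t: "t < N"
  defines "u \<equiv> (1 / L $$ (t, t)) \<cdot>\<^sub>v col (X * L) t"
  shows "perp_proj (cols_from X (Suc t)) *\<^sub>v col X t = u"
    and "u \<bullet> u \<le> col X t \<bullet> col X t"
proof -
  note ch = cholesky_orthonormal[OF X inj L]
  let ?A = "cols_from X (Suc t)"
  define z where "z = unit_vec N t - (1 / L $$ (t, t)) \<cdot>\<^sub>v col L t"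
  define x where "x = vec (N - Suc t) (\<lambda>i. z $ (Suc t + i))"
  have A: "?A \<in> carrier_mat m (N - Suc t)" by (rule cols_from_carrier[OF X])
  have cL: "col L t \<in> carrier_vec N" using ch(1) by auto
  have u: "u \<in> carrier_vec m" using X by (intro carrier_vecI) (simp add: u_def)
  have z: "z \<in> carrier_vec N" using cL by (simp add: z_def)
  have x: "x \<in> carrier_vec (N - Suc t)" by (simp add: x_def)
  \<comment> \<open>Before index \<open>t\<close> both terms of \<open>z\<close> vanish, since
    \<open>L\<close> is lower triangular; at \<open>t\<close> they cancel because of the factor
    \<open>1 / L $$ (t, t)\<close>.\<close>
  have z0: "z $ i = 0" if "i < Suc t" "i < N" for i
    using that ch(1) t ch(2)[of i t] ch(3)[of t] by (cases "i = t") (auto simp: z_def)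
  have "?A *\<^sub>v x = X *\<^sub>v z"
    unfolding x_def by (rule cols_from_mult_vec[OF X z z0])
  also have "\<dots> = X *\<^sub>v unit_vec N t - X *\<^sub>v ((1 / L $$ (t, t)) \<cdot>\<^sub>v col L t)"
    unfolding z_def by (rule mult_minus_distrib_mat_vec[OF X]) (use cL in auto)
  also have "X *\<^sub>v ((1 / L $$ (t, t)) \<cdot>\<^sub>v col L t) = u"
    unfolding u_def col_mult2[OF X ch(1) t] by (rule mult_mat_vec[OF X cL])
  also have "X *\<^sub>v unit_vec N t = col X t"
    using X t by (intro eq_vecI) auto
  finally have Ax: "?A *\<^sub>v x = col X t - u" .
  have split: "u + ?A *\<^sub>v x = col X t"
    unfolding Ax using X u by (intro eq_vecI) auto
  \<comment> \<open>Up to scaling, each entry is an entry of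
    \<open>transpose_mat (X * L) * X\<close> strictly above the diagonal.\<close>
  have Au: "transpose_mat ?A *\<^sub>v u = 0\<^sub>v (N - Suc t)"
  proof (rule eq_vecI)
    fix k assume "k < dim_vec (0\<^sub>v (N - Suc t) :: real vec)"
    then have k: "Suc t + k < N" by simp
    have "(transpose_mat ?A *\<^sub>v u) $ k = col X (Suc t + k) \<bullet> u"
      using k A X by (simp add: cols_from_col)
    also have "\<dots> = 1 / L $$ (t, t) * (col X (Suc t + k) \<bullet> col (X * L) t)"
      unfolding u_def by (rule scalar_prod_smult_distrib[of _ m]) (use X in \<open>auto intro!: carrier_vecI\<close>)
    also have "col X (Suc t + k) \<bullet> col (X * L) t = col (X * L) t \<bullet> col X (Suc t + k)"
      by (rule comm_scalar_prod[of _ m]) (use X in \<open>auto intro!: carrier_vecI\<close>)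
    also have "\<dots> = (transpose_mat (X * L) * X) $$ (t, Suc t + k)"
      using X ch(1) k t by (simp del: col_mult2 col_mult)
    also have "\<dots> = 0" by (rule ch(5)) (use k in auto)
    finally show "(transpose_mat ?A *\<^sub>v u) $ k = 0\<^sub>v (N - Suc t) $ k" using k by simp
  qed (use A in simp)
  show "perp_proj ?A *\<^sub>v col X t = u"
    using perp_proj_mult_eq[OF A cols_from_inj[OF X inj] u Au x] unfolding split .
  have Axm: "?A *\<^sub>v x \<in> carrier_vec m" using A x by auto
  have uA: "u \<bullet> (?A *\<^sub>v x) = 0"
    using transpose_vec_mult_scalar[OF A x u] Au x by simp
  have Au': "(?A *\<^sub>v x) \<bullet> u = 0" using uA comm_scalar_prod[OF Axm u] by simp
  have "col X t \<bullet> col X t = u \<bullet> u + (?A *\<^sub>v x) \<bullet> (?A *\<^sub>v x)"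
    unfolding split[symmetric] using u Axm uA Au'
    by (simp add: add_scalar_prod_distrib[of _ m] scalar_prod_add_distrib[of _ m])
  then show "u \<bullet> u \<le> col X t \<bullet> col X t" using scalar_prod_self_ge_0[of "?A *\<^sub>v x"] by simp
qed

section \<open>Sums of vectors and Pythagoras\<close>

lemma finsum_vec_lessThan_Suc:
  fixes f :: "nat \<Rightarrow> 'a :: comm_monoid_add vec"
  assumes "\<And>j. j \<le> t \<Longrightarrow> f j \<in> carrier_vec m"
  shows "finsum_vec TYPE('a) m f {..<Suc t} = f t + finsum_vec TYPE('a) m f {..<t}"
  using assms unfolding lessThan_Suc by (subst finsum_vec_insert) auto

text \<open>Induction on partial sums: each one is orthogonal to all later terms
  (\<open>orthS\<close>), so adding a term adds only its own square.\<close>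

lemma finsum_vec_pythagoras:
  fixes f :: "nat \<Rightarrow> real vec"
  assumes f: "\<And>j. j < n \<Longrightarrow> f j \<in> carrier_vec m"
    and orth: "\<And>i j. i < j \<Longrightarrow> j < n \<Longrightarrow> f i \<bullet> f j = 0"
  shows "finsum_vec TYPE(real) m f {..<n} \<bullet> finsum_vec TYPE(real) m f {..<n} = (\<Sum>j<n. f j \<bullet> f j)"
proof -
  let ?S = "\<lambda>t. finsum_vec TYPE(real) m f {..<t}"
  have S: "?S t \<in> carrier_vec m" if "t \<le> n" for t
    using that f by (intro finsum_vec_closed) auto
  have orthS: "?S t \<bullet> f s = 0" if "t \<le> s" "s < n" for s t
    using that
  proof (induction t)
    case 0 then show ?case using f by (simp add: finsum_vec_empty)
  next
    case (Suc t)
    then show ?case using f orth S[of t]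
      by (simp add: finsum_vec_lessThan_Suc add_scalar_prod_distrib[of _ m])
  qed
  have "?S t \<bullet> ?S t = (\<Sum>j<t. f j \<bullet> f j)" if "t \<le> n" for t
    using that
  proof (induction t)
    case 0 then show ?case by (simp add: finsum_vec_empty)
  next
    case (Suc t)
    have "f t \<bullet> ?S t = 0"
      using orthS[of t t] Suc f S[of t] comm_scalar_prod[of "f t" m "?S t"] by simp
    then show ?case using Suc f S[of t] orthS[of t t]
      by (simp add: finsum_vec_lessThan_Suc add_scalar_prod_distrib[of _ m]
          scalar_prod_add_distrib[of _ m])
  qed
  then show ?thesis by simp
qed

lemma mult_mat_vec_finsum_cols:
  fixes X :: "real mat"
  assumes X: "X \<in> carrier_mat m N" and v: "v \<in> carrier_vec N" and t: "t \<le> N"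
  shows "X *\<^sub>v v = finsum_vec TYPE(real) m (\<lambda>j. (v $ j) \<cdot>\<^sub>v col X j) {..<t}
                 + finsum_vec TYPE(real) m (\<lambda>j. (v $ j) \<cdot>\<^sub>v col X j) {t..<N}"
    (is "_ = ?f {..<t} + ?f {t..<N}")
proof (rule eq_vecI)
  have F: "?f I \<in> carrier_vec m" for I using X by (intro finsum_vec_closed) auto
  then have Fd: "dim_vec (?f I) = m" for I by (metis carrier_vecD)
  show "dim_vec (X *\<^sub>v v) = dim_vec (?f {..<t} + ?f {t..<N})" using X Fd by simp
  fix i assume "i < dim_vec (?f {..<t} + ?f {t..<N})"
  then have i: "i < m" using Fd by simp
  have f: "?f I $ i = (\<Sum>j\<in>I. X $$ (i, j) * v $ j)" if "finite I" "I \<subseteq> {..<N}" for I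
    using X i that by (subst index_finsum_vec) (auto intro!: sum.cong)
  have "(X *\<^sub>v v) $ i = (\<Sum>j<N. X $$ (i, j) * v $ j)"
    using X v i by (simp add: scalar_prod_def atLeast0LessThan)
  also have "\<dots> = (\<Sum>j<t. X $$ (i, j) * v $ j) + (\<Sum>j\<in>{t..<N}. X $$ (i, j) * v $ j)"
    using t by (subst sum.union_disjoint[symmetric]) (auto simp: ivl_disj_un ivl_disj_int)
  also have "\<dots> = ?f {..<t} $ i + ?f {t..<N} $ i"
    using t f[of "{..<t}"] f[of "{t..<N}"] by fastforce
  finally show "(X *\<^sub>v v) $ i = (?f {..<t} + ?f {t..<N}) $ i"
    using i Fd by simp
qed

section \<open>The OPTQ iteration\<close>

lemma optq_state_carrier: "w \<in> carrier_vec N \<Longrightarrow> optq_state Q L w t \<in> carrier_vec N"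
  by (cases t) (auto simp: Let_def)

text \<open>The three cases of the definition merge into one column update:
  \<open>L $$ (i, t) = 0\<close> for \<open>i < t\<close> leaves the quantized entries alone, and at
  \<open>t\<close> the quotient is 1, which yields \<open>Q (v $ t)\<close>.\<close>

lemma optq_state_Suc:
  fixes Q :: "real \<Rightarrow> real"
  assumes L: "L \<in> carrier_mat N N"
    and tri: "\<And>i j. i < j \<Longrightarrow> j < N \<Longrightarrow> L $$ (i, j) = 0"
    and diag: "\<And>i. i < N \<Longrightarrow> L $$ (i, i) \<noteq> 0"
    and w: "w \<in> carrier_vec N" and t: "t < N"
  defines "v \<equiv> optq_state Q L w t"
  shows "optq_state Q L w (Suc t) = v - ((v $ t - Q (v $ t)) / L $$ (t, t)) \<cdot>\<^sub>v col L t"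
proof -
  have v: "v \<in> carrier_vec N" unfolding v_def by (rule optq_state_carrier[OF w])
  show ?thesis
    using L w v t tri[of _ t] diag[of t]
    by (intro eq_vecI) (auto simp: Let_def v_def[symmetric] field_simps)
qed

text \<open>Entry \<open>j\<close> is set in step \<open>j + 1\<close>, from the state after
  \<open>j\<close> steps, and never changes again. For \<open>t = N\<close> this links the output to
  the intermediate states.\<close>

lemma optq_state_stable:
  assumes w: "w \<in> carrier_vec N" and jt: "j < t" "t \<le> N"
  shows "optq_state Q L w t $ j = Q (optq_state Q L w j $ j)"
  using jt
proof (induction t)
  case (Suc t)
  then show ?case using w by (cases "j = t") (auto simp: Let_def)
qed simp

section \<open>Rounding error and Frobenius norm\<close>

text \<open>\<open>Q z\<close> is at least as close to \<open>z\<close> as the grid point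
  \<open>p\<close> obtained by rounding \<open>z / \<delta>\<close>, however ties are
  broken.\<close>

lemma quantizer_infinite_alphabet_error:
  assumes Q: "is_quantizer (infinite_alphabet \<delta>) Q" and \<delta>: "0 < \<delta>"
  shows "\<bar>z - Q z\<bar> \<le> \<delta> / 2"
proof -
  define p where "p = of_int (round (z / \<delta>)) * \<delta>"
  have "p \<in> infinite_alphabet \<delta>" by (auto simp: p_def infinite_alphabet_def)
  then have "\<bar>z - Q z\<bar> \<le> \<bar>z - p\<bar>"
    using Q by (auto simp: is_quantizer_def is_arg_min_def not_less)
  also have "z - p = (z / \<delta> - of_int (round (z / \<delta>))) * \<delta>"
    using \<delta> by (simp add: p_def field_simps)
  also have "\<bar>\<dots>\<bar> = \<bar>of_int (round (z / \<delta>)) - z / \<delta>\<bar> * \<delta>"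
    using \<delta> by (simp add: abs_mult abs_minus_commute)
  also have "\<dots> \<le> 1 / 2 * \<delta>"
    using \<delta> of_int_round_abs_le[of "z / \<delta>"] by (intro mult_right_mono) auto
  finally show ?thesis by simp
qed

lemma frobenius_norm_square_cols:
  assumes "X \<in> carrier_mat m N"
  shows "(frobenius_norm X)\<^sup>2 = (\<Sum>j<N. col X j \<bullet> col X j)"
proof -
  have "(frobenius_norm X)\<^sup>2 = (\<Sum>i<m. \<Sum>j<N. (X $$ (i, j))\<^sup>2)"
    using assms by (simp add: frobenius_norm_def sum_nonneg)
  also have "\<dots> = (\<Sum>j<N. \<Sum>i<m. (X $$ (i, j))\<^sup>2)" by (rule sum.swap)
  also have "\<dots> = (\<Sum>j<N. col X j \<bullet> col X j)"
    using assms by (auto simp: scalar_prod_def power2_eq_square atLeast0LessThan intro!: sum.cong)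
  finally show ?thesis .
qed

section \<open>Error recursion, norm identity and bounds for OPTQ\<close>

theorem proposition3p2:
  fixes X L :: "real mat" and w q :: "real vec" and m N :: nat
    and \<A> :: "real set" and Q :: "real \<Rightarrow> real"
    and W e :: "nat \<Rightarrow> real vec" and P :: "nat \<Rightarrow> real mat"
  assumes X: "X \<in> carrier_mat m N"
    and mN: "N \<le> m"
    and full_rank: "vec_space.rank m X = min m N"
    and w: "w \<in> carrier_vec N"
    and Q: "is_quantizer \<A> Q"
    and L: "is_cholesky_factor (the (mat_inverse (transpose_mat X * X))) L"
    and W: "W = optq_state Q L w"
    and q: "q = W N"
    and e: "e = (\<lambda>t. X *\<^sub>v w - X *\<^sub>v W t)"
    and P: "P = (\<lambda>j. perp_proj (cols_from X j))"
  shows "(\<forall>t\<le>N. e t = X *\<^sub>v w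
             - finsum_vec TYPE(real) m (\<lambda>j. (q $ j) \<cdot>\<^sub>v col X j) {..<t}
             - finsum_vec TYPE(real) m (\<lambda>j. (W t $ j) \<cdot>\<^sub>v col X j) {t..<N})
    \<and> (\<forall>t<N. e (Suc t) = P (Suc t) *\<^sub>v ((W t $ t - q $ t) \<cdot>\<^sub>v col X t) + e t)
    \<and> e N = finsum_vec TYPE(real) m
             (\<lambda>j. P (Suc j) *\<^sub>v ((W j $ j - q $ j) \<cdot>\<^sub>v col X j)) {..<N}
    \<and> (vec_norm2 (X *\<^sub>v w - X *\<^sub>v q))\<^sup>2
         = (\<Sum>j<N. \<bar>W j $ j - q $ j\<bar>\<^sup>2 * (vec_norm2 (P (Suc j) *\<^sub>v col X j))\<^sup>2)
    \<and> (\<forall>\<delta>>0. \<A> = infinite_alphabet \<delta> \<longrightarrow>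
         vec_norm2 (X *\<^sub>v w - X *\<^sub>v q)
           \<le> \<delta> / 2 * sqrt (real N)
             * min (MAX j\<in>{..<N}. vec_norm2 (P (Suc j) *\<^sub>v col X j))
                   (sqrt ((frobenius_norm X)\<^sup>2 / real N)))"
proof -
  have rank: "vec_space.rank m X = N" using full_rank mN by simp
  have inj: "\<forall>v\<in>carrier_vec N. X *\<^sub>v v = 0\<^sub>v m \<longrightarrow> v = 0\<^sub>v N"
    using vec_space.full_col_rank_mult_eq_0[OF X rank] by blast
  note ch = cholesky_orthonormal[OF X inj L]
  \<comment> \<open>\<open>u t\<close> is the projected column of \<open>perp_proj_col\<close>, and
    \<open>r t\<close> is the error of rounding entry \<open>t\<close>, taken just before that entry
    is quantized.\<close>
  define u where "u = (\<lambda>t. (1 / L $$ (t, t)) \<cdot>\<^sub>v col (X * L) t)"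
  define r where "r = (\<lambda>t. W t $ t - q $ t)"
  have Wc: "W t \<in> carrier_vec N" for t unfolding W by (rule optq_state_carrier[OF w])
  have uc: "u t \<in> carrier_vec m" for t using X by (intro carrier_vecI) (simp add: u_def)
  have Pu: "P (Suc t) *\<^sub>v col X t = u t" and u_le: "u t \<bullet> u t \<le> col X t \<bullet> col X t" if "t < N" for t
    using perp_proj_col[OF X inj L that] by (simp_all add: P u_def)
  have q_eq: "q $ j = Q (W j $ j)" if "j < N" for j
    using optq_state_stable[OF w that order_refl] by (simp add: q W)
  have stable: "W t $ j = q $ j" if "j < t" "t \<le> N" for j t
    using optq_state_stable[OF w that] q_eq that by (simp add: W)
  have Pr: "P (Suc t) *\<^sub>v (r t \<cdot>\<^sub>v col X t) = r t \<cdot>\<^sub>v u t" if "t < N" for t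
  proof -
    have "P (Suc t) \<in> carrier_mat m m" unfolding P
      by (rule perp_proj_carrier[OF cols_from_carrier[OF X] cols_from_inj[OF X inj]])
    then show ?thesis using mult_mat_vec[of "P (Suc t)" m m "col X t" "r t"] Pu[OF that] X that by simp
  qed

  have e_split: "e t = X *\<^sub>v w
             - finsum_vec TYPE(real) m (\<lambda>j. (q $ j) \<cdot>\<^sub>v col X j) {..<t}
             - finsum_vec TYPE(real) m (\<lambda>j. (W t $ j) \<cdot>\<^sub>v col X j) {t..<N}" if "t \<le> N" for t
  proof -
    let ?f = "\<lambda>x I. finsum_vec TYPE(real) m (\<lambda>j. (x $ j) \<cdot>\<^sub>v col X j) I"
    have F: "?f x I \<in> carrier_vec m" for x I using X by (intro finsum_vec_closed) auto
    have "?f (W t) {..<t} = ?f q {..<t}"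
    proof (rule eq_vecI)
      fix i assume "i < dim_vec (?f q {..<t})"
      then have i: "i < m" using F by (metis carrier_vecD)
      show "?f (W t) {..<t} $ i = ?f q {..<t} $ i"
        using X i stable[OF _ that] by (auto simp: index_finsum_vec Pi_def intro!: sum.cong)
    qed (metis F carrier_vecD)
    then have "X *\<^sub>v W t = ?f q {..<t} + ?f (W t) {t..<N}"
      using mult_mat_vec_finsum_cols[OF X Wc that] by simp
    moreover have "X *\<^sub>v w - (?f q {..<t} + ?f (W t) {t..<N}) = X *\<^sub>v w - ?f q {..<t} - ?f (W t) {t..<N}"
    proof -
      have "X *\<^sub>v w \<in> carrier_vec m" using X w by auto
      with F[of q "{..<t}"] F[of "W t" "{t..<N}"] show ?thesis by (intro eq_vecI) auto
    qed
    ultimately show ?thesis by (simp add: e)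
  qed

  \<comment> \<open>Applying \<open>X\<close> to the column update turns the subtracted multiple of
    \<open>col L t\<close> into \<open>r t \<cdot>\<^sub>v u t\<close>.\<close>
  have step: "e (Suc t) = r t \<cdot>\<^sub>v u t + e t" if t: "t < N" for t
  proof -
    have Lt: "col L t \<in> carrier_vec N" using ch(1) by auto
    have diag: "L $$ (i, i) \<noteq> 0" if "i < N" for i using ch(3)[OF that] by simp
    have "W (Suc t) = W t - (r t / L $$ (t, t)) \<cdot>\<^sub>v col L t"
      using optq_state_Suc[OF ch(1) ch(2) diag w t] by (simp only: r_def W q_eq[OF t])
    then have "X *\<^sub>v W (Suc t) = X *\<^sub>v W t - X *\<^sub>v ((r t / L $$ (t, t)) \<cdot>\<^sub>v col L t)"
      using mult_minus_distrib_mat_vec[OF X Wc] Lt by simp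
    also have "X *\<^sub>v ((r t / L $$ (t, t)) \<cdot>\<^sub>v col L t) = r t \<cdot>\<^sub>v u t"
      unfolding mult_mat_vec[OF X Lt] u_def col_mult2[OF X ch(1) t] by (simp add: smult_smult_assoc)
    finally have XW: "X *\<^sub>v W (Suc t) = X *\<^sub>v W t - r t \<cdot>\<^sub>v u t" .
    show ?thesis unfolding e XW using X uc[of t] by (intro eq_vecI) auto
  qed

  have sum_e: "e t = finsum_vec TYPE(real) m (\<lambda>j. r j \<cdot>\<^sub>v u j) {..<t}" if "t \<le> N" for t
    using that
  proof (induction t)
    case 0
    have "X *\<^sub>v w \<in> carrier_vec m" using X w by auto
    then show ?case by (simp add: e W finsum_vec_empty)
  next
    case (Suc t)
    then show ?case using uc by (simp add: step finsum_vec_lessThan_Suc)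
  qed

  \<comment> \<open>The columns of \<open>X * L\<close> are orthonormal, and scaling preserves
    orthogonality.\<close>
  have orth: "(r i \<cdot>\<^sub>v u i) \<bullet> (r j \<cdot>\<^sub>v u j) = 0" if "i < j" "j < N" for i j
  proof -
    have "col (X * L) i \<bullet> col (X * L) j = (transpose_mat (X * L) * (X * L)) $$ (i, j)"
      using X ch(1) that by (simp del: col_mult2 col_mult)
    also have "\<dots> = 0" unfolding ch(4) using that by simp
    finally show ?thesis
      using X by (simp add: u_def)
  qed

  have norm: "(vec_norm2 (X *\<^sub>v w - X *\<^sub>v q))\<^sup>2
         = (\<Sum>j<N. \<bar>r j\<bar>\<^sup>2 * (vec_norm2 (P (Suc j) *\<^sub>v col X j))\<^sup>2)"
  proof -
    have "(vec_norm2 (X *\<^sub>v w - X *\<^sub>v q))\<^sup>2 = e N \<bullet> e N" by (simp add: vec_norm2_square e q)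
    also have "\<dots> = (\<Sum>j<N. (r j \<cdot>\<^sub>v u j) \<bullet> (r j \<cdot>\<^sub>v u j))"
      unfolding sum_e[OF order_refl] by (rule finsum_vec_pythagoras) (use uc orth in auto)
    also have "\<dots> = (\<Sum>j<N. \<bar>r j\<bar>\<^sup>2 * (vec_norm2 (P (Suc j) *\<^sub>v col X j))\<^sup>2)"
      by (simp add: vec_norm2_square Pu power2_eq_square[of "r _"] mult.assoc)
    finally show ?thesis .
  qed

  have sum_P: "e N = finsum_vec TYPE(real) m (\<lambda>j. P (Suc j) *\<^sub>v (r j \<cdot>\<^sub>v col X j)) {..<N}"
  proof (rule eq_vecI)
    let ?S = "finsum_vec TYPE(real) m (\<lambda>j. P (Suc j) *\<^sub>v (r j \<cdot>\<^sub>v col X j)) {..<N}"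
    have "?S \<in> carrier_vec m" using Pr uc by (intro finsum_vec_closed) auto
    moreover have "e N \<in> carrier_vec m" using X by (intro carrier_vecI) (simp add: e)
    ultimately show d: "dim_vec (e N) = dim_vec ?S" by simp
    fix i assume "i < dim_vec ?S"
    then have "i < m" using \<open>?S \<in> carrier_vec m\<close> by simp
    then show "e N $ i = ?S $ i"
      unfolding sum_e[OF order_refl] using Pr uc by (simp add: index_finsum_vec Pi_def)
  qed

  have bound: "vec_norm2 (X *\<^sub>v w - X *\<^sub>v q)
           \<le> \<delta> / 2 * sqrt (real N)
             * min (MAX j\<in>{..<N}. vec_norm2 (P (Suc j) *\<^sub>v col X j))
                   (sqrt ((frobenius_norm X)\<^sup>2 / real N))"
    if \<delta>: "0 < \<delta>" "\<A> = infinite_alphabet \<delta>" for \<delta>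
  \<comment> \<open>For \<open>N = 0\<close> the maximum ranges over the empty set and the quotient
    divides by 0, but the factor \<open>sqrt (real N)\<close> makes the right-hand side 0, and the
    error is 0 by \<open>norm\<close>.\<close>
  proof (cases "N = 0")
    case True
    then show ?thesis using norm by simp
  next
    case False
    let ?E = "vec_norm2 (X *\<^sub>v w - X *\<^sub>v q)" and ?p = "\<lambda>j. vec_norm2 (P (Suc j) *\<^sub>v col X j)"
    have r: "\<bar>r j\<bar> \<le> \<delta> / 2" if "j < N" for j
      unfolding r_def q_eq[OF that] using Q \<delta> by (intro quantizer_infinite_alphabet_error) auto
    have "?E\<^sup>2 \<le> (\<Sum>j<N. (\<delta> / 2)\<^sup>2 * (?p j)\<^sup>2)"
      unfolding norm by (intro sum_mono mult_right_mono power_mono r) auto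
    then have E: "?E\<^sup>2 \<le> (\<delta> / 2)\<^sup>2 * (\<Sum>j<N. (?p j)\<^sup>2)" by (simp add: sum_distrib_left)
    \<comment> \<open>Both terms of the minimum are instances of \<open>c\<close>: any upper bound
      for the root mean square of the projected norms \<open>?p j\<close> will do.\<close>
    have main: "?E \<le> \<delta> / 2 * sqrt (real N) * c"
      if c: "0 \<le> c" "(\<Sum>j<N. (?p j)\<^sup>2) \<le> real N * c\<^sup>2" for c
    proof (rule power2_le_imp_le)
      have "?E\<^sup>2 \<le> (\<delta> / 2)\<^sup>2 * (real N * c\<^sup>2)"
        using E mult_left_mono[OF c(2), of "(\<delta> / 2)\<^sup>2"] by simp
      then show "?E\<^sup>2 \<le> (\<delta> / 2 * sqrt (real N) * c)\<^sup>2"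
        by (simp only: power_mult_distrib mult.assoc real_sqrt_pow2 of_nat_0_le_iff)
    qed (use \<delta> c in auto)
    let ?M = "MAX j\<in>{..<N}. ?p j"
    have M: "?p j \<le> ?M" if "j < N" for j using that by (intro Max_ge) auto
    have 1: "?E \<le> \<delta> / 2 * sqrt (real N) * ?M"
    proof (rule main)
      show "0 \<le> ?M" using M[of 0] False vec_norm2_ge_0 order_trans by blast
      have "(\<Sum>j<N. (?p j)\<^sup>2) \<le> (\<Sum>j<N. ?M\<^sup>2)"
        by (intro sum_mono power_mono M vec_norm2_ge_0) auto
      then show "(\<Sum>j<N. (?p j)\<^sup>2) \<le> real N * ?M\<^sup>2" by simp
    qed
    \<comment> \<open>Here \<open>real N * c\<^sup>2\<close> is the squared Frobenius norm, and
      projecting does not lengthen a column (\<open>u_le\<close>).\<close>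
    have 2: "?E \<le> \<delta> / 2 * sqrt (real N) * sqrt ((frobenius_norm X)\<^sup>2 / real N)"
    proof (rule main)
      have "(\<Sum>j<N. (?p j)\<^sup>2) \<le> (\<Sum>j<N. col X j \<bullet> col X j)"
        by (intro sum_mono) (simp add: vec_norm2_square Pu u_le)
      then show "(\<Sum>j<N. (?p j)\<^sup>2) \<le> real N * (sqrt ((frobenius_norm X)\<^sup>2 / real N))\<^sup>2"
        using False by (simp add: frobenius_norm_square_cols[OF X] sum_nonneg scalar_prod_self_ge_0)
    qed simp
    show ?thesis using 1 2 by (simp add: min_def)
  qed

  have step_P: "e (Suc t) = P (Suc t) *\<^sub>v (r t \<cdot>\<^sub>v col X t) + e t" if "t < N" for t
    using step[OF that] Pr[OF that] by simp
  show ?thesis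
    using e_split step_P[unfolded r_def] sum_P[unfolded r_def] norm[unfolded r_def] bound by blast
qed

end
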